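(* Let $k\ge1$, and consider call types $R=\{0,1,\dots,k\}$ with parameters $\nu_r>0$, $\mu_r>0$, $\kappa_r=\nu_r/\mu_r$ ($r\in R$), and capacities $0<c_r<\infty$ ($r=1,\dots,k$). Let feasibility of a control $\boldsymbol{b}$ mean that $b_0(\boldsymbol{n})+b_r(\boldsymbol{n})\le c_r$ for all $r=1,\dots,k$ and all $\boldsymbol{n}=(n_0,n_1,\dots,n_k)\in\mathbb{Z}_+^{k+1}$. Assume that $$\kappa_0+\kappa_r<c_r,\qquad r=1,\dots,k.$$ For $\boldsymbol{n}\in\mathbb{Z}_+^{k+1}$ put $\hat n_{\max}=\max(n_1,\dots,n_k)$. Then, given any $\delta>0$, there is an $a\ge1$ (depending only on $\nu_r,\mu_r,c_j$ and $\delta$) such that every Pareto efficient control $\boldsymbol{b}$ for which there exists a finite set $F\subset\mathbb{Z}_+^{k+1}$ with $$\kappa_0-b_0(\boldsymbol{n})\le-\delta\qquad\text{whenever }\hat n_{\max}<a\text{ and }\boldsymbol{n}\notin F$$ is stable.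
   Context: $\mathbb{Z}_+=\{0,1,2,\dots\}$. A control is a function $\boldsymbol{b}=(b_r,\,r\in R):\mathbb{Z}_+^{k+1}\to[0,\infty)^{k+1}$ with $b_r(\boldsymbol{n})=0$ whenever $n_r=0$. It defines the continuous-time Markov process $\boldsymbol{n}(\cdot)$ on $\mathbb{Z}_+^{k+1}$ with transitions, for $r\in R$: $\boldsymbol{n}\to\boldsymbol{n}+\boldsymbol{e}_r$ at rate $\nu_r$ and $\boldsymbol{n}\to\boldsymbol{n}-\boldsymbol{e}_r$ at rate $\mu_r b_r(\boldsymbol{n})$, where $\boldsymbol{e}_r$ is the unit vector in coordinate $r$. The control is stable if this process is positive recurrent. There are resources $1,\dots,k$ with capacities $c_1,\dots,c_k$; calls of type $r\in\{1,\dots,k\}$ use only resource $r$, while calls of type $0$ use all the resources $1,\dots,k$. For a feasible control, resource $j$ is saturated at $\boldsymbol{n}$ if $b_0(\boldsymbol{n})+b_j(\boldsymbol{n})=c_j$. A control is Pareto efficient if it is feasible and, for all $\boldsymbol{n}$ and all $r\in R$ with $n_r>0$, at least one of the resources used by type $r$ is saturated at $\boldsymbol{n}$. *)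

theory Defs
  imports "HOL-Probability.Probability"
begin

section \<open>Continuous-time Markov chains given by their transition rates\<close>

text \<open>
  \<^term>\<open>Q x y\<close> is the rate of the transition from \<^term>\<open>x\<close> to \<^term>\<open>y\<close> (zero for
  \<^prop>\<open>x = y\<close>), and every total rate out of a state is assumed to lie strictly between zero and
  infinity.  The chain is built from its jump chain and its holding times.
\<close>

definition exit_rate :: "('s \<Rightarrow> 's \<Rightarrow> real) \<Rightarrow> 's \<Rightarrow> real" where
  "exit_rate Q x = (\<Sum>\<^sub>\<infinity>y. Q x y)"

definition jump_pmf :: "('s \<Rightarrow> 's \<Rightarrow> real) \<Rightarrow> 's \<Rightarrow> 's pmf" where
  "jump_pmf Q x = embed_pmf (\<lambda>y. Q x y / exit_rate Q x)"

definition jump_hold :: "('s \<Rightarrow> 's \<Rightarrow> real) \<Rightarrow> 's \<Rightarrow> ('s \<times> real) measure" where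
  "jump_hold Q x =
     measure_pmf (jump_pmf Q x) \<Otimes>\<^sub>M density lborel (exponential_density (exit_rate Q x))"

text \<open>
  A sample point is a stream whose \<open>i\<close>-th element holds, for every state \<open>x\<close>, the pair (next state,
  holding time) to be used should the chain be in \<open>x\<close> after its \<open>i\<close>-th jump; all these pairs are
  independent.  Each is read at most once, so given the past the next pair has law
  \<^term>\<open>jump_hold Q x\<close>.
\<close>

definition sample_space :: "('s \<Rightarrow> 's \<Rightarrow> real) \<Rightarrow> ('s \<Rightarrow> 's \<times> real) stream measure" where
  "sample_space Q = stream_space (\<Pi>\<^sub>M x\<in>UNIV. jump_hold Q x)"

primrec jump_chain :: "'s \<Rightarrow> ('s \<Rightarrow> 's \<times> real) stream \<Rightarrow> nat \<Rightarrow> 's" where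
  "jump_chain x \<omega> 0 = x"
| "jump_chain x \<omega> (Suc i) = fst ((\<omega> !! i) (jump_chain x \<omega> i))"

definition holding_time :: "'s \<Rightarrow> ('s \<Rightarrow> 's \<times> real) stream \<Rightarrow> nat \<Rightarrow> real" where
  "holding_time x \<omega> i = snd ((\<omega> !! i) (jump_chain x \<omega> i))"

definition jump_time :: "'s \<Rightarrow> ('s \<Rightarrow> 's \<times> real) stream \<Rightarrow> nat \<Rightarrow> real" where
  "jump_time x \<omega> i = (\<Sum>j<i. holding_time x \<omega> j)"

text \<open>The state at time \<open>t\<close> of the chain started in \<open>x\<close>, or \<^const>\<open>None\<close> after an explosion.\<close>

definition chain_at :: "'s \<Rightarrow> ('s \<Rightarrow> 's \<times> real) stream \<Rightarrow> real \<Rightarrow> 's option" where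
  "chain_at x \<omega> t =
     (if \<exists>i. t < jump_time x \<omega> (Suc i)
      then Some (jump_chain x \<omega> (LEAST i. t < jump_time x \<omega> (Suc i)))
      else None)"

text \<open>The infimum is \<open>\<infinity>\<close> if the chain never returns.\<close>

definition return_time :: "'s \<Rightarrow> ('s \<Rightarrow> 's \<times> real) stream \<Rightarrow> ennreal" where
  "return_time x \<omega> = Inf {ennreal t | t. jump_time x \<omega> 1 \<le> t \<and> chain_at x \<omega> t = Some x}"

definition positive_recurrent :: "('s \<Rightarrow> 's \<Rightarrow> real) \<Rightarrow> bool" where
  "positive_recurrent Q \<longleftrightarrow> (\<forall>x. (\<integral>\<^sup>+\<omega>. return_time x \<omega> \<partial>sample_space Q) < \<infinity>)"


section \<open>Controls\<close>

text \<open>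
  The resources are the elements of a finite type \<open>'k\<close>.  The call types are the elements of
  \<open>'k option\<close>: \<^const>\<open>None\<close> is type \<open>0\<close>, and \<^term>\<open>Some j\<close> is the type that uses only
  resource \<^term>\<open>j\<close>.
\<close>

type_synonym 'k state = "'k option \<Rightarrow> nat"
type_synonym 'k control = "'k state \<Rightarrow> 'k option \<Rightarrow> real"

fun resources_used :: "'k option \<Rightarrow> 'k set" where
  "resources_used None = UNIV"
| "resources_used (Some j) = {j}"

definition is_control :: "'k control \<Rightarrow> bool" where
  "is_control b \<longleftrightarrow> (\<forall>n r. 0 \<le> b n r) \<and> (\<forall>n r. n r = 0 \<longrightarrow> b n r = 0)"

definition feasible :: "('k \<Rightarrow> real) \<Rightarrow> 'k control \<Rightarrow> bool" where
  "feasible c b \<longleftrightarrow> is_control b \<and> (\<forall>n j. b n None + b n (Some j) \<le> c j)"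

definition saturated :: "('k \<Rightarrow> real) \<Rightarrow> 'k control \<Rightarrow> 'k state \<Rightarrow> 'k \<Rightarrow> bool" where
  "saturated c b n j \<longleftrightarrow> b n None + b n (Some j) = c j"

definition pareto_efficient :: "('k \<Rightarrow> real) \<Rightarrow> 'k control \<Rightarrow> bool" where
  "pareto_efficient c b \<longleftrightarrow>
     feasible c b \<and> (\<forall>n r. n r > 0 \<longrightarrow> (\<exists>j\<in>resources_used r. saturated c b n j))"

text \<open>
  For \<^prop>\<open>n r = 0\<close> the truncated \<^term>\<open>n r - 1\<close> is harmless, since then a control
  satisfies \<^prop>\<open>b n r = 0\<close>.
\<close>

definition transition_rate ::
    "('k::finite option \<Rightarrow> real) \<Rightarrow> ('k option \<Rightarrow> real) \<Rightarrow> 'k control \<Rightarrow> 'k state \<Rightarrow> 'k state \<Rightarrow> real"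
  where
  "transition_rate \<nu> \<mu> b n m =
     (\<Sum>r\<in>UNIV. (if m = n(r := n r + 1) then \<nu> r else 0)
              + (if m = n(r := n r - 1) then \<mu> r * b n r else 0))"

definition stable_control ::
    "('k::finite option \<Rightarrow> real) \<Rightarrow> ('k option \<Rightarrow> real) \<Rightarrow> 'k control \<Rightarrow> bool" where
  "stable_control \<nu> \<mu> b \<longleftrightarrow> positive_recurrent (transition_rate \<nu> \<mu> b)"

definition n_hat_max :: "'k::finite state \<Rightarrow> nat" where
  "n_hat_max n = Max (range (\<lambda>j. n (Some j)))"

end

theory Submission imports Defs begin

text \<open>
  Write \<open>w\<^sub>r = n\<^sub>r / \<mu>\<^sub>r\<close>. The function
  \<open>V = w\<^sub>0 + ln (D + \<Sum>\<^sub>j exp (\<theta> w\<^sub>j)) / \<theta>\<close> behaves like \<open>w\<^sub>0\<close> while all \<open>w\<^sub>j\<close> are small and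
  like \<open>w\<^sub>0 + max\<^sub>j w\<^sub>j\<close> when some \<open>w\<^sub>j\<close> is large.  Up to an error of order \<open>\<theta>\<close>, its drift is a convex
  combination, with weights proportional to \<open>D\<close> and \<open>exp (\<theta> w\<^sub>j)\<close>, of \<open>\<kappa>\<^sub>0 - b\<^sub>0\<close> and of
  \<open>\<kappa>\<^sub>0 + \<kappa>\<^sub>j - b\<^sub>0 - b\<^sub>j\<close>.  If \<open>n\<^sub>j > 0\<close>, the latter is \<open>\<kappa>\<^sub>0 + \<kappa>\<^sub>j - c\<^sub>j < 0\<close> by saturation; if \<open>n\<^sub>j = 0\<close>,
  its weight is at most \<open>1 / D\<close>.  The first one is at most \<open>-\<delta>\<close> when all \<open>n\<^sub>j < a\<close>, and otherwise its
  weight is negligible once \<open>a\<close> is large compared with \<open>D\<close> and \<open>1 / \<theta>\<close>.  So the drift is bounded away from \<open>0\<close>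
  off \<open>F\<close>, and Foster's criterion applies.

  For Foster's criterion, \<open>V\<close> is corrected by a bounded function so that the only exceptional state is
  the target \<open>z\<close>; the result dominates the expected return time to \<open>z\<close> by a first-step analysis of the
  sample streams.
\<close>

section \<open>Expected return times from superharmonic functions\<close>

locale finite_range_rates =
  fixes Q :: "'s::countable \<Rightarrow> 's \<Rightarrow> real"
  assumes rate_nonneg: "0 \<le> Q x y"
    and finite_range: "finite {y. Q x y \<noteq> 0}"
    and exit_rate_pos: "0 < exit_rate Q x"
begin

definition succs :: "'s \<Rightarrow> 's set" where
  "succs x = {y. Q x y \<noteq> 0}"

lemma finite_succs [simp]: "finite (succs x)"
  using finite_range by (simp add: succs_def)

lemma exit_rate_eq_sum: "exit_rate Q x = (\<Sum>y\<in>succs x. Q x y)"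
proof -
  have "exit_rate Q x = (\<Sum>\<^sub>\<infinity>y\<in>succs x. Q x y)"
    unfolding exit_rate_def by (rule infsum_cong_neutral) (auto simp: succs_def)
  then show ?thesis by simp
qed

lemma pmf_jump_pmf: "pmf (jump_pmf Q x) y = Q x y / exit_rate Q x"
  unfolding jump_pmf_def
proof (rule pmf_embed_pmf)
  show "0 \<le> Q x y / exit_rate Q x" for y
    using rate_nonneg exit_rate_pos[of x] by simp
  have "(\<integral>\<^sup>+y. ennreal (Q x y / exit_rate Q x) \<partial>count_space UNIV)
      = (\<Sum>y\<in>succs x. ennreal (Q x y / exit_rate Q x))"
    by (rule nn_integral_count_space'[OF finite_succs]) (auto simp: succs_def)
  also have "\<dots> = ennreal (\<Sum>y\<in>succs x. Q x y / exit_rate Q x)"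
    using rate_nonneg exit_rate_pos[of x] by (intro sum_ennreal) simp
  also have "(\<Sum>y\<in>succs x. Q x y / exit_rate Q x) = 1"
    using exit_rate_pos[of x] by (simp add: sum_divide_distrib[symmetric] exit_rate_eq_sum)
  finally show "(\<integral>\<^sup>+y. ennreal (Q x y / exit_rate Q x) \<partial>count_space UNIV) = 1"
    by simp
qed

lemma prob_space_jump_hold: "prob_space (jump_hold Q x)"
proof -
  interpret E: prob_space "density lborel (exponential_density (exit_rate Q x))"
    by (rule prob_space_exponential_density[OF exit_rate_pos])
  interpret pair_prob_space "measure_pmf (jump_pmf Q x)"
    "density lborel (exponential_density (exit_rate Q x))" ..
  show ?thesis unfolding jump_hold_def by (rule P.prob_space_axioms)
qed

lemma sets_jump_hold [measurable_cong]:
  "sets (jump_hold Q x) = sets (count_space UNIV \<Otimes>\<^sub>M borel)"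
  unfolding jump_hold_def by (intro sets_pair_measure_cong) auto

lemma prob_space_jump_hold_PiM: "prob_space (\<Pi>\<^sub>M x\<in>UNIV. jump_hold Q x)"
  by (intro prob_space_PiM prob_space_jump_hold)

lemma nn_integral_exponential_hold:
  "(\<integral>\<^sup>+h. ennreal h \<partial>density lborel (exponential_density (exit_rate Q x)))
    = ennreal (1 / exit_rate Q x)"
proof -
  have "(\<integral>\<^sup>+h. ennreal h \<partial>density lborel (exponential_density (exit_rate Q x)))
      = (\<integral>\<^sup>+h. ennreal (exponential_density (exit_rate Q x) h) * ennreal h \<partial>lborel)"
    by (subst nn_integral_density) auto
  also have "\<dots> = (\<integral>\<^sup>+h. ennreal (erlang_density 0 (exit_rate Q x) h * h ^ 1) \<partial>lborel)"
    using exit_rate_pos[of x]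
    by (intro nn_integral_cong) (auto simp: ennreal_mult' erlang_density_def)
  also have "\<dots> = ennreal (1 / exit_rate Q x)"
    using nn_integral_erlang_ith_moment[OF exit_rate_pos[of x], of 0 1] by simp
  finally show ?thesis .
qed

text \<open>One-step expectation for the first-step analysis: the holding time has mean
  \<open>1 / exit_rate Q x\<close> whatever the next state is, and the \<open>1\<close> is the extra
  charge per jump.\<close>

lemma nn_integral_jump_hold:
  fixes f :: "'s \<Rightarrow> real"
  assumes "\<And>y. 0 \<le> f y"
  shows "(\<integral>\<^sup>+p. 1 + ennreal (snd p) + ennreal (f (fst p)) \<partial>jump_hold Q x)
    = ennreal (1 + 1 / exit_rate Q x + (\<Sum>y\<in>succs x. Q x y / exit_rate Q x * f y))"
proof -
  interpret E: prob_space "density lborel (exponential_density (exit_rate Q x))"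
    by (rule prob_space_exponential_density[OF exit_rate_pos])
  have q: "0 < exit_rate Q x" by (rule exit_rate_pos)
  have "(\<integral>\<^sup>+p. 1 + ennreal (snd p) + ennreal (f (fst p)) \<partial>jump_hold Q x)
      = (\<integral>\<^sup>+y. (\<integral>\<^sup>+h. 1 + ennreal h + ennreal (f y)
          \<partial>density lborel (exponential_density (exit_rate Q x))) \<partial>measure_pmf (jump_pmf Q x))"
    unfolding jump_hold_def by (subst E.nn_integral_fst[symmetric]) auto
  also have "\<dots> = (\<integral>\<^sup>+y. 1 + ennreal (1 / exit_rate Q x) + ennreal (f y) \<partial>measure_pmf (jump_pmf Q x))"
    by (intro nn_integral_cong)
      (simp add: nn_integral_add nn_integral_exponential_hold E.emeasure_space_1[simplified])
  also have "\<dots> = 1 + ennreal (1 / exit_rate Q x) + (\<integral>\<^sup>+y. ennreal (f y) \<partial>measure_pmf (jump_pmf Q x))"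
    by (simp add: nn_integral_add measure_pmf.emeasure_space_1[simplified])
  also have "(\<integral>\<^sup>+y. ennreal (f y) \<partial>measure_pmf (jump_pmf Q x))
      = (\<Sum>y\<in>succs x. ennreal (f y) * ennreal (Q x y / exit_rate Q x))"
    by (subst nn_integral_measure_pmf_support[OF finite_succs[of x]])
      (auto simp: set_pmf_iff pmf_jump_pmf succs_def)
  also have "\<dots> = (\<Sum>y\<in>succs x. ennreal (Q x y / exit_rate Q x * f y))"
    using assms rate_nonneg q by (intro sum.cong refl) (subst mult.commute, subst ennreal_mult, auto)
  also have "\<dots> = ennreal (\<Sum>y\<in>succs x. Q x y / exit_rate Q x * f y)"
    using assms rate_nonneg q by (intro sum_ennreal) simp
  also have "1 + ennreal (1 / exit_rate Q x) + \<dots>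
      = ennreal (1 + 1 / exit_rate Q x + (\<Sum>y\<in>succs x. Q x y / exit_rate Q x * f y))"
    using assms rate_nonneg q by (simp add: ennreal_plus sum_nonneg flip: ennreal_1)
  finally show ?thesis .
qed

lemma AE_jump_hold_pos: "AE p in jump_hold Q x. 0 < snd p"
proof -
  interpret E: prob_space "density lborel (exponential_density (exit_rate Q x))"
    by (rule prob_space_exponential_density[OF exit_rate_pos])
  interpret P: pair_prob_space "measure_pmf (jump_pmf Q x)"
    "density lborel (exponential_density (exit_rate Q x))" ..
  \<comment> \<open>The exponential density vanishes on the negative reals, so only the null set of
    the point \<open>0\<close> has to be excluded.\<close>
  have "AE h in lborel. h \<noteq> (0::real)"
    by (rule AE_lborel_singleton)
  then have "AE h in density lborel (exponential_density (exit_rate Q x)). 0 < h"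
    by (subst AE_density) (auto simp: exponential_density_def elim!: eventually_mono)
  then show ?thesis
    unfolding jump_hold_def
    by (intro P.AE_pair_measure) (auto intro!: AE_I2)
qed

end

section \<open>Pathwise bounds for the return time\<close>

lemma jump_chain_Cons:
  "jump_chain x (s ## \<omega>) (Suc i) = jump_chain (fst (s x)) \<omega> i"
  by (induction i) auto

lemma jump_time_Cons:
  "jump_time x (s ## \<omega>) (Suc n) = snd (s x) + jump_time (fst (s x)) \<omega> n"
  unfolding jump_time_def
  by (subst sum.lessThan_Suc_shift) (simp add: holding_time_def jump_chain_Cons del: jump_chain.simps(2))

text \<open>
  Each jump costs its holding time plus \<open>1\<close>, so that the limit of the cost is infinite on the
  paths that never reach \<open>z\<close>, even if they explode.
\<close>

primrec hit_cost :: "'s \<Rightarrow> nat \<Rightarrow> 's \<Rightarrow> ('s \<Rightarrow> 's \<times> real) stream \<Rightarrow> ennreal" where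
  "hit_cost z 0 x \<omega> = 0"
| "hit_cost z (Suc n) x \<omega> = 1 + ennreal (snd (shd \<omega> x)) +
     (if fst (shd \<omega> x) = z then 0 else hit_cost z n (fst (shd \<omega> x)) (stl \<omega>))"

lemma hit_cost_0: "hit_cost z 0 x = (\<lambda>_. 0)"
  by auto

lemma hit_cost_mono: "hit_cost z n x \<omega> \<le> hit_cost z (Suc n) x \<omega>"
proof (induction n arbitrary: x \<omega>)
  case (Suc n)
  then show ?case by (auto intro!: add_left_mono simp del: hit_cost.simps(2)
        simp: hit_cost.simps(2)[of z "Suc n"] hit_cost.simps(2)[of z n])
qed simp

lemma hit_cost_ge_length:
  assumes "\<And>i. 1 \<le> i \<Longrightarrow> i \<le> n \<Longrightarrow> jump_chain x \<omega> i \<noteq> z"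
  shows "of_nat n \<le> hit_cost z n x \<omega>"
  using assms
proof (induction n arbitrary: x \<omega>)
  case (Suc n)
  have shift: "jump_chain x \<omega> (Suc i) = jump_chain (fst (shd \<omega> x)) (stl \<omega>) i" for i
    using jump_chain_Cons[of x "shd \<omega>" "stl \<omega>" i] by simp
  have "of_nat n \<le> hit_cost z n (fst (shd \<omega> x)) (stl \<omega>)"
  proof (rule Suc.IH)
    fix i assume "1 \<le> i" "i \<le> n"
    then show "jump_chain (fst (shd \<omega> x)) (stl \<omega>) i \<noteq> z"
      using Suc.prems[of "Suc i"] by (simp only: shift) simp
  qed
  moreover have "fst (shd \<omega> x) \<noteq> z"
    using Suc.prems[of 1] by simp
  ultimately show ?case
    by (auto intro!: add_increasing simp: add.assoc)
qed simp

text \<open>\<open>ennreal\<close> sends negative reals to \<open>0\<close>, so without sign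
  assumptions only subadditivity survives. It lets the comparison with jump times hold on every
  stream, even where holding times are negative.\<close>

lemma ennreal_add_le: "ennreal (a + b) \<le> ennreal a + ennreal b"
proof (cases "0 \<le> a \<and> 0 \<le> b")
  case False
  then consider "b \<le> 0" | "a \<le> 0" by linarith
  then show ?thesis
  proof cases
    case 1
    then have "ennreal (a + b) \<le> ennreal a" by (intro ennreal_leI) simp
    then show ?thesis by (rule add_increasing2[rotated]) simp
  next
    case 2
    then have "ennreal (a + b) \<le> ennreal b" by (intro ennreal_leI) simp
    then show ?thesis by (rule add_increasing[rotated]) simp
  qed
qed simp

lemma hit_cost_ge_jump_time:
  assumes "\<And>i. 1 \<le> i \<Longrightarrow> i < n \<Longrightarrow> jump_chain x \<omega> i \<noteq> z"
  shows "ennreal (jump_time x \<omega> n) \<le> hit_cost z n x \<omega>"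
  using assms
proof (induction n arbitrary: x \<omega>)
  case 0
  then show ?case by (simp add: jump_time_def)
next
  case (Suc n)
  have shift: "jump_chain x \<omega> (Suc i) = jump_chain (fst (shd \<omega> x)) (stl \<omega>) i" for i
    using jump_chain_Cons[of x "shd \<omega>" "stl \<omega>" i] by simp
  have t: "jump_time x \<omega> (Suc n) = snd (shd \<omega> x) + jump_time (fst (shd \<omega> x)) (stl \<omega>) n"
    using jump_time_Cons[of x "shd \<omega>" "stl \<omega>" n] by simp
  have IH: "ennreal (jump_time (fst (shd \<omega> x)) (stl \<omega>) n) \<le> hit_cost z n (fst (shd \<omega> x)) (stl \<omega>)"
  proof (rule Suc.IH)
    fix i assume "1 \<le> i" "i < n"
    then show "jump_chain (fst (shd \<omega> x)) (stl \<omega>) i \<noteq> z"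
      using Suc.prems[of "Suc i"] by (simp only: shift) simp
  qed
  have "ennreal (jump_time x \<omega> (Suc n))
      \<le> ennreal (snd (shd \<omega> x)) + ennreal (jump_time (fst (shd \<omega> x)) (stl \<omega>) n)"
    unfolding t by (rule ennreal_add_le)
  also have "\<dots> \<le> hit_cost z (Suc n) x \<omega>"
  \<comment> \<open>For \<open>n = 0\<close> the only jump may already lead to \<open>z\<close>,
    since the hypothesis excludes \<open>z\<close> strictly before the last jump only; the remaining
    time is then \<open>0\<close>.\<close>
  proof (cases "n = 0")
    case True
    then show ?thesis by (simp add: jump_time_def)
  next
    case False
    then have "fst (shd \<omega> x) \<noteq> z"
      using Suc.prems[of 1] by simp
    then show ?thesis
      using IH by (auto intro!: add_mono simp: add_increasing)
  qed
  finally show ?case .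
qed

text \<open>Positive holding times make the jump times strictly increasing, so the
  \<open>LEAST\<close> index in \<open>chain_at\<close> at the time of the \<open>N\<close>-th jump
  is exactly \<open>N\<close>.\<close>

lemma return_time_le_jump_time:
  assumes pos: "\<And>i. 0 < holding_time x \<omega> i"
    and N: "1 \<le> N" "jump_chain x \<omega> N = x"
  shows "return_time x \<omega> \<le> ennreal (jump_time x \<omega> N)"
proof -
  have mono: "strict_mono (jump_time x \<omega>)"
    by (rule strict_monoI_Suc) (simp add: jump_time_def pos)
  have "(LEAST i. jump_time x \<omega> N < jump_time x \<omega> (Suc i)) = N"
    using strict_mono_less[OF mono] by (intro Least_equality) auto
  moreover have "jump_time x \<omega> N < jump_time x \<omega> (Suc N)"
    using strict_mono_less[OF mono] by auto
  ultimately have "chain_at x \<omega> (jump_time x \<omega> N) = Some x"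
    unfolding chain_at_def using N by auto
  moreover have "jump_time x \<omega> 1 \<le> jump_time x \<omega> N"
    using strict_mono_less_eq[OF mono] N by auto
  ultimately show ?thesis
    unfolding return_time_def by (intro Inf_lower) auto
qed

text \<open>At the first return the jump time is dominated by the cost. Without a return the cost of
  \<open>n\<close> jumps is at least \<open>n\<close>, so the supremum is infinite and recurrence
  need not be known beforehand.\<close>

lemma return_time_le_hit_cost:
  assumes pos: "\<And>i. 0 < holding_time x \<omega> i"
  shows "return_time x \<omega> \<le> (SUP n. hit_cost x n x \<omega>)"
proof (cases "\<exists>N\<ge>1. jump_chain x \<omega> N = x")
  case True
  define N where "N = (LEAST N. 1 \<le> N \<and> jump_chain x \<omega> N = x)"
  have N: "1 \<le> N" "jump_chain x \<omega> N = x"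
    using LeastI_ex[OF True[unfolded Bex_def]] unfolding N_def by auto
  have "jump_chain x \<omega> i \<noteq> x" if "1 \<le> i" "i < N" for i
    using not_less_Least[of i "\<lambda>N. 1 \<le> N \<and> jump_chain x \<omega> N = x"] that unfolding N_def by auto
  then have "ennreal (jump_time x \<omega> N) \<le> hit_cost x N x \<omega>"
    by (rule hit_cost_ge_jump_time)
  also have "\<dots> \<le> (SUP n. hit_cost x n x \<omega>)"
    by (rule SUP_upper) simp
  finally show ?thesis
    using return_time_le_jump_time[OF pos N] by (rule order_trans[rotated])
next
  case False
  then have "of_nat n \<le> (SUP n. hit_cost x n x \<omega>)" for n
    using hit_cost_ge_length[of n x \<omega> x] by (auto intro!: SUP_upper2[of n])
  then have "(SUP n. of_nat n :: ennreal) \<le> (SUP n. hit_cost x n x \<omega>)"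
    by (intro SUP_least) auto
  then show ?thesis
    unfolding ennreal_SUP_of_nat_eq_top by (metis order_trans top_greatest)
qed

section \<open>Bounding the expected hitting cost\<close>

context finite_range_rates
begin

lemma measurable_hit_cost:
  "hit_cost z n x \<in> borel_measurable (sample_space Q)"
proof (induction n arbitrary: x)
  case (Suc n)
  let ?M = "\<Pi>\<^sub>M x\<in>UNIV. jump_hold Q x"
  have [measurable]: "(\<lambda>\<omega>. shd \<omega> x) \<in> stream_space ?M \<rightarrow>\<^sub>M (count_space UNIV \<Otimes>\<^sub>M borel)" for x
  proof -
    have "(\<lambda>s. s x) \<in> ?M \<rightarrow>\<^sub>M jump_hold Q x"
      by (rule measurable_component_singleton) simp
    then have "(\<lambda>s. s x) \<in> ?M \<rightarrow>\<^sub>M (count_space UNIV \<Otimes>\<^sub>M borel)"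
      using measurable_cong_sets[OF refl sets_jump_hold] by blast
    then show ?thesis by (rule measurable_compose[OF measurable_shd])
  qed
  have [measurable]: "(\<lambda>\<omega>. hit_cost z n y (stl \<omega>)) \<in> borel_measurable (stream_space ?M)" for y
    using Suc[of y] unfolding sample_space_def by (rule measurable_compose[OF measurable_stl])
  \<comment> \<open>The start of the remaining path is itself random; as there are countably many
    states, the measurability for each fixed start suffices.\<close>
  have [measurable]: "(\<lambda>\<omega>. hit_cost z n (fst (shd \<omega> x)) (stl \<omega>)) \<in> borel_measurable (stream_space ?M)"
    by (rule measurable_compose_countable[where g = "\<lambda>\<omega>. fst (shd \<omega> x)"]) measurable
  then show ?case
    unfolding sample_space_def hit_cost.simps by measurable
qed (simp add: hit_cost_0)

text \<open>First-step analysis: the head of the stream is independent of its tail, so integrating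
  the tail first replaces the remaining cost by \<open>u\<close> at the new state. Only arrival in
  \<open>z\<close> is free, hence for \<open>x = z\<close> the bound concerns the return to
  \<open>z\<close>.\<close>

lemma nn_integral_hit_cost_le:
  fixes u :: "'s \<Rightarrow> real"
  assumes u_nonneg: "\<And>x. 0 \<le> u x"
    and super: "\<And>x. 1 + 1 / exit_rate Q x
      + (\<Sum>y\<in>succs x. Q x y / exit_rate Q x * (if y = z then 0 else u y)) \<le> u x"
  shows "(\<integral>\<^sup>+\<omega>. hit_cost z n x \<omega> \<partial>sample_space Q) \<le> ennreal (u x)"
proof (induction n arbitrary: x)
  case (Suc n)
  let ?M = "\<Pi>\<^sub>M x\<in>UNIV. jump_hold Q x"
  interpret M: prob_space ?M by (rule prob_space_jump_hold_PiM)
  interpret S: prob_space "stream_space ?M" by (rule M.prob_space_stream_space)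
  have step: "(\<integral>\<^sup>+\<omega>. hit_cost z (Suc n) x (s ## \<omega>) \<partial>stream_space ?M)
      \<le> 1 + ennreal (snd (s x)) + ennreal (if fst (s x) = z then 0 else u (fst (s x)))" for s
  proof -
    have [measurable]: "hit_cost z n y \<in> borel_measurable (stream_space ?M)" for y
      using measurable_hit_cost unfolding sample_space_def .
    have "(\<integral>\<^sup>+\<omega>. hit_cost z (Suc n) x (s ## \<omega>) \<partial>stream_space ?M)
      = 1 + ennreal (snd (s x)) +
        (\<integral>\<^sup>+\<omega>. (if fst (s x) = z then 0 else hit_cost z n (fst (s x)) \<omega>) \<partial>stream_space ?M)"
      by (cases "fst (s x) = z") (simp_all add: nn_integral_add S.emeasure_space_1)
    also have "\<dots> \<le> 1 + ennreal (snd (s x)) + ennreal (if fst (s x) = z then 0 else u (fst (s x)))"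
      using Suc.IH[of "fst (s x)"] unfolding sample_space_def by (auto intro!: add_left_mono)
    finally show ?thesis .
  qed
  have "(\<integral>\<^sup>+\<omega>. hit_cost z (Suc n) x \<omega> \<partial>sample_space Q)
      = (\<integral>\<^sup>+s. (\<integral>\<^sup>+\<omega>. hit_cost z (Suc n) x (s ## \<omega>) \<partial>stream_space ?M) \<partial>?M)"
    unfolding sample_space_def
    by (rule M.nn_integral_stream_space) (rule measurable_hit_cost[unfolded sample_space_def])
  also have "\<dots> \<le> (\<integral>\<^sup>+s. 1 + ennreal (snd (s x))
      + ennreal (if fst (s x) = z then 0 else u (fst (s x))) \<partial>?M)"
    by (intro nn_integral_mono step)
  also have "\<dots> = (\<integral>\<^sup>+p. 1 + ennreal (snd p) + ennreal (if fst p = z then 0 else u (fst p))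
      \<partial>distr ?M (jump_hold Q x) (\<lambda>s. s x))"
    by (subst nn_integral_distr) auto
  \<comment> \<open>The first step reads only coordinate \<open>x\<close> of the head, whose law is
    the corresponding factor of the product.\<close>
  also have "distr ?M (jump_hold Q x) (\<lambda>s. s x) = jump_hold Q x"
    by (rule distr_PiM_component) (auto intro: prob_space_jump_hold)
  also have "(\<integral>\<^sup>+p. 1 + ennreal (snd p) + ennreal (if fst p = z then 0 else u (fst p)) \<partial>jump_hold Q x)
      = ennreal (1 + 1 / exit_rate Q x
      + (\<Sum>y\<in>succs x. Q x y / exit_rate Q x * (if y = z then 0 else u y)))"
    by (rule nn_integral_jump_hold[where f = "\<lambda>y. if y = z then 0 else u y"]) (simp add: u_nonneg)
  also have "\<dots> \<le> ennreal (u x)"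
    by (rule ennreal_leI[OF super])
  finally show ?case .
qed (simp add: hit_cost_0)

text \<open>Positivity is shown for all countably many states at every index at once, so the random
  position of the chain does not matter.\<close>

lemma AE_holding_time_pos: "AE \<omega> in sample_space Q. \<forall>i. 0 < holding_time x \<omega> i"
proof -
  let ?M = "\<Pi>\<^sub>M x\<in>UNIV. jump_hold Q x"
  interpret M: prob_space ?M by (rule prob_space_jump_hold_PiM)
  have [measurable]: "(\<lambda>s. s y) \<in> ?M \<rightarrow>\<^sub>M (count_space UNIV \<Otimes>\<^sub>M borel)" for y
  proof -
    have "(\<lambda>s. s y) \<in> ?M \<rightarrow>\<^sub>M jump_hold Q y"
      by (rule measurable_component_singleton) simp
    then show ?thesis
      using measurable_cong_sets[OF refl sets_jump_hold] by blast
  qed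
  have "AE s in ?M. \<forall>y. 0 < snd (s y)"
    unfolding AE_all_countable
    by (intro allI AE_PiM_component) (auto intro: prob_space_jump_hold AE_jump_hold_pos)
  then have "AE \<omega> in stream_space ?M. stream_all (\<lambda>s. \<forall>y. 0 < snd (s y)) \<omega>"
    by (intro M.AE_stream_all) measurable
  then show ?thesis
    unfolding sample_space_def
    by (rule eventually_mono) (simp add: stream_all_def holding_time_def)
qed

text \<open>The bound \<open>u z\<close> is uniform in the number of jumps and passes to the
  supremum by monotone convergence.\<close>

lemma nn_integral_return_time_finite:
  fixes u :: "'s \<Rightarrow> real"
  assumes "\<And>x. 0 \<le> u x"
    and "\<And>x. 1 + 1 / exit_rate Q x
      + (\<Sum>y\<in>succs x. Q x y / exit_rate Q x * (if y = z then 0 else u y)) \<le> u x"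
  shows "(\<integral>\<^sup>+\<omega>. return_time z \<omega> \<partial>sample_space Q) < \<infinity>"
proof -
  have "(\<integral>\<^sup>+\<omega>. return_time z \<omega> \<partial>sample_space Q) \<le> (\<integral>\<^sup>+\<omega>. (SUP n. hit_cost z n z \<omega>) \<partial>sample_space Q)"
    using AE_holding_time_pos[of z]
    by (intro nn_integral_mono_AE, elim eventually_mono) (auto intro: return_time_le_hit_cost)
  also have "\<dots> = (SUP n. \<integral>\<^sup>+\<omega>. hit_cost z n z \<omega> \<partial>sample_space Q)"
    by (intro nn_integral_monotone_convergence_SUP measurable_hit_cost incseq_SucI le_funI hit_cost_mono)
  also have "\<dots> \<le> ennreal (u z)"
    by (intro SUP_least nn_integral_hit_cost_le assms)
  finally show ?thesis
    by (simp add: le_less_trans)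
qed


section \<open>Foster's criterion\<close>

text \<open>The probability that the jump chain from \<open>x\<close> visits \<open>z\<close> within
  \<open>i\<close> jumps, the start included, given by its recursion instead of through the sample
  streams.\<close>

primrec hit_prob :: "'s \<Rightarrow> nat \<Rightarrow> 's \<Rightarrow> real" where
  "hit_prob z 0 x = (if x = z then 1 else 0)"
| "hit_prob z (Suc i) x =
     (if x = z then 1 else (\<Sum>y\<in>succs x. Q x y * hit_prob z i y) / exit_rate Q x)"

lemma hit_prob_nonneg: "0 \<le> hit_prob z i x"
proof (induction i arbitrary: x)
  case (Suc i)
  then show ?case
    using rate_nonneg exit_rate_pos[of x] by (auto intro!: divide_nonneg_pos sum_nonneg)
qed simp

lemma hit_prob_le_1: "hit_prob z i x \<le> 1"
proof (induction i arbitrary: x)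
  case (Suc i)
  have "(\<Sum>y\<in>succs x. Q x y * hit_prob z i y) \<le> exit_rate Q x"
    unfolding exit_rate_eq_sum
    using Suc rate_nonneg by (intro sum_mono) (metis mult_left_mono mult.right_neutral)
  then show ?case
    using exit_rate_pos[of x] by (simp add: divide_le_eq)
qed simp

lemma hit_prob_mono: "mono (\<lambda>i. hit_prob z i x)"
proof (rule monoI, rule lift_Suc_mono_le)
  show "hit_prob z n x \<le> hit_prob z (Suc n) x" for n
  proof (induction n arbitrary: x)
    case 0
    have "0 \<le> hit_prob z (Suc 0) x" by (rule hit_prob_nonneg)
    then show ?case by (cases "x = z") auto
  next
    case (Suc n)
    have "(\<Sum>y\<in>succs x. Q x y * hit_prob z n y) \<le> (\<Sum>y\<in>succs x. Q x y * hit_prob z (Suc n) y)"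
      using Suc rate_nonneg by (intro sum_mono mult_left_mono) auto
    then show ?case
      using exit_rate_pos[of x]
      by (simp only: hit_prob.simps(2)[of z "Suc n"] hit_prob.simps(2)[of z n]) (auto intro: divide_right_mono)
  qed
qed

lemma hit_prob_pos:
  assumes "(x, z) \<in> {(x, y). 0 < Q x y}\<^sup>*"
  shows "\<exists>i. 0 < hit_prob z i x"
  using assms
proof (induction rule: converse_rtrancl_induct)
  case base
  then show ?case by (auto intro: exI[of _ 0])
next
  case (step x y)
  then obtain i where i: "0 < hit_prob z i y" and xy: "0 < Q x y" by auto
  have "0 < Q x y * hit_prob z i y" using i xy by simp
  also have "\<dots> \<le> (\<Sum>y\<in>succs x. Q x y * hit_prob z i y)"
    using xy by (intro member_le_sum) (auto simp: succs_def rate_nonneg hit_prob_nonneg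
        finite_range)
  finally have "0 < hit_prob z (Suc i) x"
    using exit_rate_pos[of x] by simp
  then show ?case ..
qed

definition generator :: "('s \<Rightarrow> real) \<Rightarrow> 's \<Rightarrow> real" where
  "generator f x = (\<Sum>y\<in>succs x. Q x y * (f y - f x))"

lemma generator_eq: "generator f x = (\<Sum>y\<in>succs x. Q x y * f y) - exit_rate Q x * f x"
  by (simp add: generator_def exit_rate_eq_sum right_diff_distrib sum_subtractf sum_distrib_right)

text \<open>
  Off \<open>z\<close> the generator telescopes the sum of the probabilities of not hitting \<open>z\<close> early, leaving a
  negative drift wherever \<open>z\<close> can be reached in \<open>m\<close> steps.
\<close>

lemma generator_sum_hit_prob:
  assumes "x \<noteq> z"
  shows "generator (\<lambda>x. \<Sum>i<m. 1 - hit_prob z i x) x = - exit_rate Q x * hit_prob z m x"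
proof (induction m)
  case 0
  then show ?case using assms by (simp add: generator_def)
next
  case (Suc m)
  have "generator (\<lambda>x. \<Sum>i<Suc m. 1 - hit_prob z i x) x
      = generator (\<lambda>x. \<Sum>i<m. 1 - hit_prob z i x) x + generator (\<lambda>x. 1 - hit_prob z m x) x"
    by (simp add: generator_def sum.distrib[symmetric] algebra_simps)
  also have "generator (\<lambda>x. 1 - hit_prob z m x) x
      = exit_rate Q x * hit_prob z m x - (\<Sum>y\<in>succs x. Q x y * hit_prob z m y)"
    by (simp add: generator_eq exit_rate_eq_sum right_diff_distrib sum_subtractf)
  also have "(\<Sum>y\<in>succs x. Q x y * hit_prob z m y) = exit_rate Q x * hit_prob z (Suc m) x"
    using assms exit_rate_pos[of x] by simp
  finally show ?case using Suc by simp
qed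

text \<open>The bound \<open>q\<close> converts drift per unit of time into decrease per jump: the
  cost \<open>1 + 1 / exit_rate Q x\<close> is at most
  \<open>(q + 1) / exit_rate Q x\<close>.\<close>

theorem foster_positive_recurrent:
  fixes V :: "'s \<Rightarrow> real"
  assumes bounded: "\<And>x. exit_rate Q x \<le> q"
    and irreducible: "\<And>x z. (x, z) \<in> {(x, y). 0 < Q x y}\<^sup>*"
    and V_nonneg: "\<And>x. 0 \<le> V x"
    and F: "finite F"
    and \<epsilon>: "0 < \<epsilon>"
    and drift: "\<And>x. x \<notin> F \<Longrightarrow> generator V x \<le> - \<epsilon>"
  shows "positive_recurrent Q"
  unfolding positive_recurrent_def
proof
  fix z
  obtain i where i: "\<And>x. 0 < hit_prob z (i x) x"
    using hit_prob_pos[OF irreducible] by metis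
  \<comment> \<open>One number of jumps that serves all of \<open>F\<close>: it is at least each
    \<open>i x\<close>, and \<open>hit_prob\<close> grows with the number of jumps.\<close>
  define m where "m = (\<Sum>x\<in>F. i x)"
  have m: "0 < hit_prob z m x" if "x \<in> F" for x
  proof -
    have "i x \<le> m" unfolding m_def using that F by (intro member_le_sum) auto
    then show ?thesis using i[of x] monoD[OF hit_prob_mono, of "i x" m z x] by simp
  qed
  define W where "W = (\<lambda>x. \<Sum>i<m. 1 - hit_prob z i x)"
  have W_nonneg: "0 \<le> W x" for x
    unfolding W_def by (intro sum_nonneg) (simp add: hit_prob_le_1)
  \<comment> \<open>The sum dominates each of its quotients, so at the points of \<open>F\<close>
    other than \<open>z\<close> the negative drift of \<open>C * W\<close> outweighs
    \<open>generator V x + \<epsilon>\<close>.\<close>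
  define C where "C = (\<Sum>x\<in>F. \<bar>generator V x + \<epsilon>\<bar> / (exit_rate Q x * hit_prob z m x))"
  have C_nonneg: "0 \<le> C"
    unfolding C_def using hit_prob_nonneg exit_rate_pos
    by (intro sum_nonneg divide_nonneg_nonneg mult_nonneg_nonneg) (auto simp: less_imp_le)
  have C_ge: "generator V x + \<epsilon> \<le> C * (exit_rate Q x * hit_prob z m x)" if "x \<in> F" for x
  proof -
    have pos: "0 < exit_rate Q x * hit_prob z m x"
      using m[OF that] exit_rate_pos[of x] by simp
    have "\<bar>generator V x + \<epsilon>\<bar> / (exit_rate Q x * hit_prob z m x) \<le> C"
      unfolding C_def using that F hit_prob_nonneg exit_rate_pos
      by (intro member_le_sum divide_nonneg_nonneg mult_nonneg_nonneg) (auto simp: less_imp_le)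
    then show ?thesis using pos by (simp add: pos_divide_le_eq)
  qed
  define U where "U = (\<lambda>x. V x + C * W x)"
  have U_nonneg: "0 \<le> U x" for x
    unfolding U_def using V_nonneg W_nonneg C_nonneg by simp
  have gen_U: "generator U x \<le> - \<epsilon>" if "x \<noteq> z" for x
  proof -
    have "generator U x = generator V x + C * generator W x"
      unfolding generator_def U_def by (simp add: sum_distrib_left sum.distrib[symmetric] algebra_simps)
    also have "generator W x = - exit_rate Q x * hit_prob z m x"
      unfolding W_def by (rule generator_sum_hit_prob[OF that])
    finally have eq: "generator U x = generator V x - C * (exit_rate Q x * hit_prob z m x)" by simp
    show ?thesis
    proof (cases "x \<in> F")
      case True
      then show ?thesis using C_ge[of x] eq by simp
    next
      case False
      have "0 \<le> C * (exit_rate Q x * hit_prob z m x)"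
        using C_nonneg hit_prob_nonneg exit_rate_pos[of x] by simp
      then show ?thesis using drift[OF False] eq by simp
    qed
  qed
  \<comment> \<open>After scaling, \<open>\<beta> * U\<close> has drift at most
    \<open>- (q + 1)\<close> off \<open>z\<close>, which pays for the cost of a jump.\<close>
  define \<beta> where "\<beta> = (q + 1) / \<epsilon>"
  have \<beta>: "0 < \<beta>"
    unfolding \<beta>_def using \<epsilon> bounded[of z] exit_rate_pos[of z] by simp
  define S where "S = (\<lambda>x. 1 + 1 / exit_rate Q x
      + (\<Sum>y\<in>succs x. Q x y / exit_rate Q x * (if y = z then 0 else \<beta> * U y)))"
  \<comment> \<open>The drift at \<open>z\<close> is not controlled, but \<open>u z\<close> never
    occurs on the left of the superharmonic inequality; it can be set to exactly what one step from
    \<open>z\<close> requires.\<close>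
  define u where "u = (\<lambda>x. if x = z then S z else \<beta> * U x)"
  have S_nonneg: "0 \<le> S x" for x
    unfolding S_def using U_nonneg \<beta> rate_nonneg exit_rate_pos[of x]
    by (intro add_nonneg_nonneg sum_nonneg mult_nonneg_nonneg) auto
  have "S x \<le> u x" for x
  proof (cases "x = z")
    case False
    have e: "0 < exit_rate Q x" by (rule exit_rate_pos)
    have "(\<Sum>y\<in>succs x. Q x y / exit_rate Q x * (if y = z then 0 else \<beta> * U y))
        \<le> (\<Sum>y\<in>succs x. Q x y / exit_rate Q x * (\<beta> * U y))"
      using U_nonneg \<beta> rate_nonneg e by (intro sum_mono mult_left_mono) auto
    also have "\<dots> = \<beta> / exit_rate Q x * (\<Sum>y\<in>succs x. Q x y * U y)"
      by (simp add: sum_distrib_left mult_ac)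
    also have "\<dots> = \<beta> / exit_rate Q x * (generator U x + exit_rate Q x * U x)"
      by (simp add: generator_eq)
    also have "\<dots> \<le> \<beta> / exit_rate Q x * (- \<epsilon> + exit_rate Q x * U x)"
      using gen_U[OF False] \<beta> e by (intro mult_left_mono) auto
    also have "\<dots> = \<beta> * U x - (q + 1) / exit_rate Q x"
      using e \<epsilon> by (simp add: \<beta>_def field_simps)
    finally have "S x \<le> 1 + 1 / exit_rate Q x + (\<beta> * U x - (q + 1) / exit_rate Q x)"
      unfolding S_def by simp
    also have "\<dots> \<le> \<beta> * U x"
      using bounded[of x] e by (simp add: field_simps)
    finally show ?thesis using False by (simp add: u_def)
  qed (simp add: u_def)
  moreover have "(\<Sum>y\<in>succs x. Q x y / exit_rate Q x * (if y = z then 0 else \<beta> * U y))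
      = (\<Sum>y\<in>succs x. Q x y / exit_rate Q x * (if y = z then 0 else u y))" for x
    by (intro sum.cong) (auto simp: u_def)
  ultimately show "(\<integral>\<^sup>+\<omega>. return_time z \<omega> \<partial>sample_space Q) < \<infinity>"
    using S_nonneg U_nonneg \<beta>
    by (intro nn_integral_return_time_finite[of u]) (auto simp: S_def u_def)
qed

end


section \<open>Drift of the Lyapunov function\<close>

text \<open>For negative \<open>x\<close>, \<open>exp x * (1 - x) \<le> 1 \<le> 1 - x ^ 3\<close>,
  and \<open>1 - x\<close> is a factor of the right-hand side.\<close>

lemma exp_le_quadratic:
  fixes x :: real
  assumes "\<bar>x\<bar> \<le> 1"
  shows "exp x \<le> 1 + x + x\<^sup>2"
proof (cases "0 \<le> x")
  case True
  then show ?thesis using assms by (intro exp_bound) auto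
next
  case False
  have "1 - x \<le> exp (- x)" using exp_ge_add_one_self[of "- x"] by simp
  then have "exp x * (1 - x) \<le> exp x * exp (- x)"
    by (intro mult_left_mono) auto
  also have "\<dots> = 1" by (simp flip: exp_add)
  also have "1 \<le> (1 + x + x\<^sup>2) * (1 - x)"
  proof -
    have "(1 + x + x\<^sup>2) * (1 - x) = 1 + (- x) * x\<^sup>2"
      by (simp add: algebra_simps power2_eq_square)
    moreover have "0 \<le> (- x) * x\<^sup>2" using False by (intro mult_nonneg_nonneg) auto
    ultimately show ?thesis by simp
  qed
  finally show ?thesis using False by (simp add: mult_le_cancel_right)
qed

lemma sum_UNIV_option:
  fixes f :: "'k::finite option \<Rightarrow> real"
  shows "(\<Sum>r\<in>UNIV. f r) = f None + (\<Sum>j\<in>UNIV. f (Some j))"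
  by (simp add: UNIV_option_conv sum.reindex)

section \<open>The Markov process of a Pareto efficient control\<close>

locale pareto_control =
  fixes \<nu> \<mu> :: "'k::finite option \<Rightarrow> real" and c :: "'k \<Rightarrow> real" and b :: "'k control"
  assumes \<nu>_pos: "0 < \<nu> r" and \<mu>_pos: "0 < \<mu> r" and c_pos: "0 < c j"
    and pareto: "pareto_efficient c b"
begin

lemma b_nonneg: "0 \<le> b n r"
  and b_idle: "n r = 0 \<Longrightarrow> b n r = 0"
  and b_capacity: "b n None + b n (Some j) \<le> c j"
  and b_saturated: "n r > 0 \<Longrightarrow> \<exists>j\<in>resources_used r. b n None + b n (Some j) = c j"
  using pareto by (auto simp: pareto_efficient_def feasible_def is_control_def saturated_def)

lemma b_saturated_Some: "n (Some j) > 0 \<Longrightarrow> b n None + b n (Some j) = c j"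
  using b_saturated[of n "Some j"] by simp

lemma b_Some_le: "b n (Some j) \<le> c j"
  using b_capacity[of n j] b_nonneg[of n None] by linarith

lemma b_None_le: "b n None \<le> c j"
  using b_capacity[of n j] b_nonneg[of n "Some j"] by linarith

definition nbrs :: "'k state \<Rightarrow> 'k state set" where
  "nbrs n = range (\<lambda>r. n(r := n r + 1)) \<union> range (\<lambda>r. n(r := n r - 1))"

lemma finite_nbrs [simp]: "finite (nbrs n)"
  by (simp add: nbrs_def)

lemma transition_rate_nonneg: "0 \<le> transition_rate \<nu> \<mu> b n m"
  unfolding transition_rate_def
  using \<nu>_pos \<mu>_pos b_nonneg by (intro sum_nonneg add_nonneg_nonneg) (auto simp: less_imp_le)

lemma transition_rate_eq_0: "m \<notin> nbrs n \<Longrightarrow> transition_rate \<nu> \<mu> b n m = 0"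
  unfolding transition_rate_def nbrs_def by (intro sum.neutral) auto

text \<open>Exchanging the sums over states and types avoids any discussion of coinciding targets:
  every type with \<open>n r = 0\<close> has \<open>n\<close> itself as its departure
  target.\<close>

lemma sum_nbrs_transition_rate:
  "(\<Sum>m\<in>nbrs n. transition_rate \<nu> \<mu> b n m * f m)
    = (\<Sum>r\<in>UNIV. \<nu> r * f (n(r := n r + 1)) + \<mu> r * b n r * f (n(r := n r - 1)))"
proof -
  have "(\<Sum>m\<in>nbrs n. transition_rate \<nu> \<mu> b n m * f m)
      = (\<Sum>r\<in>UNIV. \<Sum>m\<in>nbrs n. (if m = n(r := n r + 1) then \<nu> r * f m else 0)
              + (if m = n(r := n r - 1) then \<mu> r * b n r * f m else 0))"
    unfolding transition_rate_def sum_distrib_right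
    by (subst sum.swap) (auto intro!: sum.cong simp: distrib_right)
  also have "\<dots> = (\<Sum>r\<in>UNIV. \<nu> r * f (n(r := n r + 1)) + \<mu> r * b n r * f (n(r := n r - 1)))"
    by (intro sum.cong refl) (simp add: sum.distrib sum.delta nbrs_def)
  finally show ?thesis .
qed

lemma exit_rate_transition_rate:
  "exit_rate (transition_rate \<nu> \<mu> b) n = (\<Sum>r\<in>UNIV. \<nu> r + \<mu> r * b n r)"
proof -
  have "exit_rate (transition_rate \<nu> \<mu> b) n = (\<Sum>\<^sub>\<infinity>m\<in>nbrs n. transition_rate \<nu> \<mu> b n m)"
    unfolding exit_rate_def by (rule infsum_cong_neutral) (auto simp: transition_rate_eq_0)
  then show ?thesis
    using sum_nbrs_transition_rate[of n "\<lambda>_. 1"] by simp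
qed

sublocale finite_range_rates "transition_rate \<nu> \<mu> b"
proof
  show "0 \<le> transition_rate \<nu> \<mu> b x y" for x y
    by (rule transition_rate_nonneg)
  show "finite {y. transition_rate \<nu> \<mu> b x y \<noteq> 0}" for x
    by (rule finite_subset[OF _ finite_nbrs[of x]]) (auto intro: ccontr simp: transition_rate_eq_0)
  show "0 < exit_rate (transition_rate \<nu> \<mu> b) x" for x
    unfolding exit_rate_transition_rate using \<nu>_pos \<mu>_pos b_nonneg
    by (intro sum_pos add_pos_nonneg mult_nonneg_nonneg) (auto simp: less_imp_le)
qed

lemma generator_transition_rate:
  "generator f n = (\<Sum>r\<in>UNIV. \<nu> r * (f (n(r := n r + 1)) - f n) + \<mu> r * b n r * (f (n(r := n r - 1)) - f n))"
proof -
  have "generator f n = (\<Sum>m\<in>nbrs n. transition_rate \<nu> \<mu> b n m * (f m - f n))"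
    unfolding generator_def
    by (intro sum.mono_neutral_left) (auto simp: succs_def intro: ccontr transition_rate_eq_0)
  then show ?thesis by (simp only: sum_nbrs_transition_rate)
qed

lemma exit_rate_le:
  "exit_rate (transition_rate \<nu> \<mu> b) n \<le> (\<Sum>r\<in>UNIV. \<nu> r + \<mu> r * (\<Sum>j\<in>UNIV. c j))"
  unfolding exit_rate_transition_rate
proof (intro sum_mono add_left_mono mult_left_mono)
  fix r :: "'k option"
  have "c j \<le> (\<Sum>j\<in>UNIV. c j)" for j
    using c_pos by (intro member_le_sum) (auto simp: less_imp_le)
  moreover have "\<exists>j. b n r \<le> c j"
    using b_Some_le b_None_le by (cases r) auto
  ultimately show "b n r \<le> (\<Sum>j\<in>UNIV. c j)"
    by (meson order_trans)
qed (use \<mu>_pos in \<open>auto simp: less_imp_le\<close>)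

section \<open>Irreducibility through the empty state\<close>

lemma transition_up_pos: "0 < transition_rate \<nu> \<mu> b n (n(r := n r + 1))"
  unfolding transition_rate_def
  using \<nu>_pos \<mu>_pos b_nonneg
  by (intro sum_pos2[of _ r]) (auto intro!: add_pos_nonneg simp: less_imp_le)

lemma transition_down_pos:
  assumes "0 < b n r"
  shows "0 < transition_rate \<nu> \<mu> b n (n(r := n r - 1))"
  unfolding transition_rate_def
  using \<nu>_pos \<mu>_pos b_nonneg assms
  by (intro sum_pos2[of _ r]) (auto intro!: add_nonneg_pos simp: less_imp_le)

text \<open>A nonempty system has a saturated resource of positive capacity, so some type is served;
  it has calls present because absent types get no service. It may differ from the given
  type.\<close>

lemma ex_service:
  assumes "n r > 0"
  shows "\<exists>r. n r > 0 \<and> b n r > 0"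
proof -
  obtain j where "b n None + b n (Some j) = c j"
    using b_saturated[of n r, OF assms] by auto
  then have "b n None > 0 \<or> b n (Some j) > 0"
    using c_pos[of j] by linarith
  then show ?thesis
    using b_idle[of n] by (metis less_numeral_extra(3) gr0I)
qed

lemma reach_zero: "(n, \<lambda>_. 0) \<in> {(x, y). 0 < transition_rate \<nu> \<mu> b x y}\<^sup>*"
proof (induction "\<Sum>r\<in>UNIV. n r" arbitrary: n rule: less_induct)
  case less
  show ?case
  proof (cases "n = (\<lambda>_. 0)")
    case False
    then obtain s where "n s > 0" by fastforce
    then obtain r where r: "n r > 0" "b n r > 0"
      using ex_service[of n s] by blast
    let ?n = "n(r := n r - 1)"
    have "(\<Sum>s\<in>UNIV. ?n s) < (\<Sum>s\<in>UNIV. n s)"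
      using r by (intro sum_strict_mono_ex1) (auto intro: exI[of _ r])
    then have "(?n, \<lambda>_. 0) \<in> {(x, y). 0 < transition_rate \<nu> \<mu> b x y}\<^sup>*"
      by (rule less.hyps)
    with transition_down_pos[OF r(2)] show ?thesis
      by (blast intro: converse_rtrancl_into_rtrancl)
  qed simp
qed

lemma zero_reach: "(\<lambda>_. 0, n) \<in> {(x, y). 0 < transition_rate \<nu> \<mu> b x y}\<^sup>*"
proof (induction "\<Sum>r\<in>UNIV. n r" arbitrary: n rule: less_induct)
  case less
  show ?case
  proof (cases "n = (\<lambda>_. 0)")
    case False
    then obtain r where r: "n r > 0" by fastforce
    let ?n = "n(r := n r - 1)"
    have "(\<Sum>s\<in>UNIV. ?n s) < (\<Sum>s\<in>UNIV. n s)"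
      using r by (intro sum_strict_mono_ex1) (auto intro: exI[of _ r])
    then have IH: "(\<lambda>_. 0, ?n) \<in> {(x, y). 0 < transition_rate \<nu> \<mu> b x y}\<^sup>*"
      by (rule less.hyps)
    have "n = ?n(r := ?n r + 1)"
      using r by auto
    then have "0 < transition_rate \<nu> \<mu> b ?n n"
      using transition_up_pos[of ?n r] by simp
    with IH show ?thesis
      by (blast intro: rtrancl_into_rtrancl)
  qed simp
qed

section \<open>The Lyapunov function and its drift\<close>

definition weight_sum :: "real \<Rightarrow> real \<Rightarrow> 'k state \<Rightarrow> real" where
  "weight_sum D \<theta> n = D + (\<Sum>j\<in>UNIV. exp (\<theta> * real (n (Some j)) / \<mu> (Some j)))"

definition lyapunov :: "real \<Rightarrow> real \<Rightarrow> 'k state \<Rightarrow> real" where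
  "lyapunov D \<theta> n = real (n None) / \<mu> None + ln (weight_sum D \<theta> n) / \<theta>"

lemma weight_sum_ge: "D \<le> weight_sum D \<theta> n"
  unfolding weight_sum_def by (simp add: sum_nonneg)

lemma weight_sum_ge_exp:
  assumes "0 < D"
  shows "exp (\<theta> * real (n (Some j)) / \<mu> (Some j)) \<le> weight_sum D \<theta> n"
proof -
  have "exp (\<theta> * real (n (Some j)) / \<mu> (Some j)) \<le> (\<Sum>j\<in>UNIV. exp (\<theta> * real (n (Some j)) / \<mu> (Some j)))"
    by (rule member_le_sum[of j UNIV "\<lambda>j. exp (\<theta> * real (n (Some j)) / \<mu> (Some j))"]) auto
  then show ?thesis using assms by (simp add: weight_sum_def)
qed

lemma lyapunov_None:
  "lyapunov D \<theta> (n(None := m)) - lyapunov D \<theta> n = (real m - real (n None)) / \<mu> None"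
  by (simp add: lyapunov_def weight_sum_def diff_divide_distrib)

text \<open>Concavity of \<open>ln\<close> bounds the increment by
  \<open>(Z' - Z) / (\<theta> * Z)\<close>, where \<open>Z\<close> and \<open>Z'\<close> are the old
  and new weight sums. Only the summand of \<open>j\<close> changes, and
  \<open>\<theta> \<le> \<mu> (Some j)\<close> keeps its exponent step in the range of the quadratic
  bound for \<open>exp\<close>.\<close>

lemma lyapunov_Some:
  assumes D: "0 < D" and \<theta>: "0 < \<theta>" "\<theta> \<le> \<mu> (Some j)"
    and s: "\<bar>s\<bar> = 1" "real m = real (n (Some j)) + s"
  shows "lyapunov D \<theta> (n(Some j := m)) - lyapunov D \<theta> n
    \<le> exp (\<theta> * real (n (Some j)) / \<mu> (Some j)) / weight_sum D \<theta> n
      * (s / \<mu> (Some j) + \<theta> / (\<mu> (Some j))\<^sup>2)"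
proof -
  let ?\<mu> = "\<mu> (Some j)" and ?n = "n(Some j := m)" and ?Z = "weight_sum D \<theta>"
  let ?e = "exp (\<theta> * real (n (Some j)) / ?\<mu>)"
  have \<mu>: "0 < ?\<mu>" by (rule \<mu>_pos)
  have Z: "0 < ?Z n" "0 < ?Z ?n"
    using weight_sum_ge D by (metis less_le_trans)+
  have "?Z ?n - ?Z n = exp (\<theta> * real m / ?\<mu>) - ?e"
    unfolding weight_sum_def by (simp add: sum.remove[of UNIV j])
  also have "\<dots> = ?e * (exp (\<theta> * s / ?\<mu>) - 1)"
    unfolding s(2) by (simp add: right_diff_distrib flip: exp_add) (simp add: distrib_left add_divide_distrib)
  also have "\<dots> \<le> ?e * (\<theta> * s / ?\<mu> + (\<theta> * s / ?\<mu>)\<^sup>2)"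
  proof -
    have "\<bar>\<theta> * s / ?\<mu>\<bar> \<le> 1"
      using \<theta> \<mu> s by (simp add: abs_mult)
    then show ?thesis
      using exp_le_quadratic[of "\<theta> * s / ?\<mu>"] by (intro mult_left_mono) auto
  qed
  also have "(\<theta> * s / ?\<mu>)\<^sup>2 = \<theta>\<^sup>2 / ?\<mu>\<^sup>2"
    using s(1) by (simp add: power_divide power_mult_distrib abs_square_eq_1)
  finally have diff: "?Z ?n - ?Z n \<le> ?e * (\<theta> * s / ?\<mu> + \<theta>\<^sup>2 / ?\<mu>\<^sup>2)" .
  have "lyapunov D \<theta> ?n - lyapunov D \<theta> n = (ln (?Z ?n) - ln (?Z n)) / \<theta>"
    by (simp add: lyapunov_def diff_divide_distrib)
  also have "\<dots> \<le> ((?Z ?n - ?Z n) / ?Z n) / \<theta>"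
    using \<theta> Z by (intro divide_right_mono ln_diff_le) auto
  also have "\<dots> \<le> (?e * (\<theta> * s / ?\<mu> + \<theta>\<^sup>2 / ?\<mu>\<^sup>2) / ?Z n) / \<theta>"
    using \<theta> Z diff by (intro divide_right_mono) auto
  also have "\<dots> = ?e / ?Z n * (s / ?\<mu> + \<theta> / ?\<mu>\<^sup>2)"
    using \<theta> Z \<mu> by (simp add: field_simps power2_eq_square)
  finally show ?thesis .
qed

text \<open>Measuring queues in units of \<open>1 / \<mu> r\<close> turns arrival and service rates
  into \<open>\<nu> r / \<mu> r\<close> and \<open>b n r\<close>. The second-order terms of arrivals
  and departures add up, and \<open>b n (Some j) \<le> c j\<close> bounds them uniformly in the
  state.\<close>

lemma generator_lyapunov_le:
  assumes D: "0 < D" and \<theta>: "0 < \<theta>" "\<And>j. \<theta> \<le> \<mu> (Some j)"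
  shows "generator (lyapunov D \<theta>) n \<le> \<nu> None / \<mu> None - b n None
    + (\<Sum>j\<in>UNIV. exp (\<theta> * real (n (Some j)) / \<mu> (Some j)) / weight_sum D \<theta> n
        * (\<nu> (Some j) / \<mu> (Some j) - b n (Some j)
           + \<theta> * ((\<nu> (Some j) + \<mu> (Some j) * c j) / (\<mu> (Some j))\<^sup>2)))"
proof -
  let ?L = "lyapunov D \<theta>"
  let ?d = "\<lambda>r. \<nu> r * (?L (n(r := n r + 1)) - ?L n) + \<mu> r * b n r * (?L (n(r := n r - 1)) - ?L n)"
  \<comment> \<open>The truncated \<open>n None - 1\<close> is wrong as a departure only at
    \<open>n None = 0\<close>, where the service rate vanishes.\<close>
  have "\<mu> None * b n None * (?L (n(None := n None - 1)) - ?L n) = - b n None"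
  proof (cases "n None = 0")
    case False
    then show ?thesis
      using \<mu>_pos[of None] by (simp add: lyapunov_None of_nat_diff)
  qed (simp add: b_idle)
  then have None: "?d None = \<nu> None / \<mu> None - b n None"
    by (simp add: lyapunov_None)
  have Some: "?d (Some j) \<le> exp (\<theta> * real (n (Some j)) / \<mu> (Some j)) / weight_sum D \<theta> n
        * (\<nu> (Some j) / \<mu> (Some j) - b n (Some j)
           + \<theta> * ((\<nu> (Some j) + \<mu> (Some j) * c j) / (\<mu> (Some j))\<^sup>2))" for j
  proof -
    let ?p = "exp (\<theta> * real (n (Some j)) / \<mu> (Some j)) / weight_sum D \<theta> n"
    let ?\<nu> = "\<nu> (Some j)" and ?\<mu> = "\<mu> (Some j)" and ?b = "b n (Some j)"
    have \<mu>: "0 < ?\<mu>" and \<nu>: "0 < ?\<nu>" by (rule \<mu>_pos \<nu>_pos)+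
    have p: "0 \<le> ?p"
      using weight_sum_ge[of D \<theta> n] D by simp
    have "?L (n(Some j := n (Some j) + 1)) - ?L n \<le> ?p * (1 / ?\<mu> + \<theta> / ?\<mu>\<^sup>2)"
      by (rule lyapunov_Some) (auto simp: assms)
    then have up: "?\<nu> * (?L (n(Some j := n (Some j) + 1)) - ?L n) \<le> ?\<nu> * (?p * (1 / ?\<mu> + \<theta> / ?\<mu>\<^sup>2))"
      using \<nu> by (intro mult_left_mono) auto
    have down: "?\<mu> * ?b * (?L (n(Some j := n (Some j) - 1)) - ?L n)
        \<le> ?\<mu> * ?b * (?p * (- 1 / ?\<mu> + \<theta> / ?\<mu>\<^sup>2))"
    proof (cases "n (Some j) = 0")
      case False
      have "?L (n(Some j := n (Some j) - 1)) - ?L n \<le> ?p * (- 1 / ?\<mu> + \<theta> / ?\<mu>\<^sup>2)"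
        by (rule lyapunov_Some) (use False in \<open>auto simp: assms of_nat_diff\<close>)
      then show ?thesis
        using \<mu> b_nonneg by (intro mult_left_mono) auto
    qed (simp add: b_idle)
    have "?d (Some j) \<le> ?\<nu> * (?p * (1 / ?\<mu> + \<theta> / ?\<mu>\<^sup>2)) + ?\<mu> * ?b * (?p * (- 1 / ?\<mu> + \<theta> / ?\<mu>\<^sup>2))"
      by (rule add_mono[OF up down])
    also have "\<dots> = ?p * (?\<nu> / ?\<mu> - ?b + \<theta> * ((?\<nu> + ?\<mu> * ?b) / ?\<mu>\<^sup>2))"
    proof -
      have "?\<nu> * (p * (1 / ?\<mu> + \<theta> / ?\<mu>\<^sup>2)) + ?\<mu> * ?b * (p * (- 1 / ?\<mu> + \<theta> / ?\<mu>\<^sup>2))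
        = p * (?\<nu> / ?\<mu> - ?b + \<theta> * ((?\<nu> + ?\<mu> * ?b) / ?\<mu>\<^sup>2))" for p
        using \<mu> by (simp add: field_simps power2_eq_square)
      then show ?thesis .
    qed
    also have "\<dots> \<le> ?p * (?\<nu> / ?\<mu> - ?b + \<theta> * ((?\<nu> + ?\<mu> * c j) / ?\<mu>\<^sup>2))"
      using p \<theta> \<mu> b_Some_le[of n j] by (intro mult_left_mono add_left_mono divide_right_mono) auto
    finally show ?thesis .
  qed
  have "generator ?L n = ?d None + (\<Sum>j\<in>UNIV. ?d (Some j))"
    by (subst generator_transition_rate) (rule sum_UNIV_option)
  also have "\<dots> \<le> \<nu> None / \<mu> None - b n None
    + (\<Sum>j\<in>UNIV. exp (\<theta> * real (n (Some j)) / \<mu> (Some j)) / weight_sum D \<theta> n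
        * (\<nu> (Some j) / \<mu> (Some j) - b n (Some j)
           + \<theta> * ((\<nu> (Some j) + \<mu> (Some j) * c j) / (\<mu> (Some j))\<^sup>2)))"
    unfolding None by (intro add_left_mono sum_mono Some)
  finally show ?thesis .
qed

text \<open>The convex combination contributes \<open>- \<epsilon>\<close>. Three errors of at most
  \<open>\<epsilon> / 4\<close> each come from the second-order terms, from the empty queues, and
  from the weight of \<open>D\<close> when some queue reaches \<open>a\<close>.\<close>

lemma generator_lyapunov_neg:
  assumes \<epsilon>: "0 < \<epsilon>"
    and gap: "\<And>j. \<nu> None / \<mu> None + \<nu> (Some j) / \<mu> (Some j) + \<epsilon> \<le> c j"
    and K: "\<And>j. \<nu> None / \<mu> None + \<nu> (Some j) / \<mu> (Some j) \<le> K"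
    and \<theta>: "0 < \<theta>" "\<And>j. \<theta> \<le> \<mu> (Some j)"
      "\<And>j. \<theta> * ((\<nu> (Some j) + \<mu> (Some j) * c j) / (\<mu> (Some j))\<^sup>2) \<le> \<epsilon> / 4"
    and D: "0 < D" "real CARD('k) * (K + \<epsilon>) \<le> \<epsilon> / 4 * D"
    and a: "\<And>j. (K + \<epsilon>) * D \<le> \<epsilon> / 4 * exp (\<theta> * a / \<mu> (Some j))"
    and control: "real (n_hat_max n) < a \<Longrightarrow> \<nu> None / \<mu> None - b n None \<le> - \<epsilon>"
  shows "generator (lyapunov D \<theta>) n \<le> - \<epsilon> / 4"
proof -
  let ?\<kappa> = "\<lambda>r. \<nu> r / \<mu> r" and ?Z = "weight_sum D \<theta> n"
  define M where "M = (\<lambda>j. (\<nu> (Some j) + \<mu> (Some j) * c j) / (\<mu> (Some j))\<^sup>2)"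
  define p where "p = (\<lambda>j. exp (\<theta> * real (n (Some j)) / \<mu> (Some j)) / ?Z)"
  define p0 where "p0 = D / ?Z"
  have Z: "0 < ?Z" "D \<le> ?Z"
    using weight_sum_ge[of D \<theta> n] D by auto
  have \<kappa>_pos: "0 < ?\<kappa> r" for r
    using \<nu>_pos \<mu>_pos by simp
  have K_pos: "0 < K"
    using K[of undefined] \<kappa>_pos[of None] \<kappa>_pos[of "Some undefined"] by linarith
  have p_nonneg: "0 \<le> p j" for j
    using Z by (simp add: p_def)
  have p0_nonneg: "0 \<le> p0"
    using Z D by (simp add: p0_def)
  have "D + (\<Sum>j\<in>UNIV. exp (\<theta> * real (n (Some j)) / \<mu> (Some j))) = ?Z"
    by (simp add: weight_sum_def)
  then have p_sum: "p0 + (\<Sum>j\<in>UNIV. p j) = 1"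
    using Z by (simp add: p0_def p_def add_divide_distrib[symmetric] sum_divide_distrib[symmetric])
  have p0_term: "p0 * (?\<kappa> None - b n None) \<le> - \<epsilon> * p0 + \<epsilon> / 4"
  proof (cases "real (n_hat_max n) < a")
    case True
    then have "p0 * (?\<kappa> None - b n None) \<le> p0 * (- \<epsilon>)"
      using control p0_nonneg by (intro mult_left_mono) auto
    then show ?thesis using \<epsilon> by (simp add: mult.commute)
  next
    case False
    \<comment> \<open>A longest queue now reaches \<open>a\<close>, so its exponential alone makes
      \<open>D / ?Z\<close> small. The factor is \<open>K + \<epsilon>\<close> because the claimed
      bound also contains \<open>- \<epsilon> * p0\<close>.\<close>
    have "n_hat_max n \<in> range (\<lambda>j. n (Some j))"
      unfolding n_hat_max_def by (rule Max_in) auto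
    then obtain j where j: "n_hat_max n = n (Some j)" by auto
    have "exp (\<theta> * a / \<mu> (Some j)) \<le> exp (\<theta> * real (n (Some j)) / \<mu> (Some j))"
      using False j \<theta> \<mu>_pos[of "Some j"] by (simp add: divide_right_mono mult_left_mono)
    also have "\<dots> \<le> ?Z"
      by (rule weight_sum_ge_exp[OF D(1)])
    finally have "(K + \<epsilon>) * D \<le> \<epsilon> / 4 * ?Z"
      using a[of j] \<epsilon> by (meson mult_left_mono order_trans less_imp_le divide_pos_pos zero_less_numeral)
    then have *: "p0 * (K + \<epsilon>) \<le> \<epsilon> / 4"
      using Z by (simp add: p0_def field_simps)
    have "?\<kappa> None - b n None \<le> K"
      using K[of undefined] \<kappa>_pos[of "Some undefined"] b_nonneg[of n None] by linarith
    then have "p0 * (?\<kappa> None - b n None) \<le> p0 * K"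
      using p0_nonneg by (intro mult_left_mono)
    moreover have "p0 * (K + \<epsilon>) = p0 * K + \<epsilon> * p0"
      by (simp add: algebra_simps)
    ultimately show ?thesis using * by linarith
  qed
  have p_term: "p j * (?\<kappa> None - b n None + (?\<kappa> (Some j) - b n (Some j) + \<theta> * M j))
      \<le> (- \<epsilon> * p j + \<epsilon> / 4 * p j) + (K + \<epsilon>) / D" for j
  proof -
    have "p j * (?\<kappa> None - b n None + (?\<kappa> (Some j) - b n (Some j))) \<le> - \<epsilon> * p j + (K + \<epsilon>) / D"
    proof (cases "n (Some j) = 0")
      case True
      have "?\<kappa> None - b n None + (?\<kappa> (Some j) - b n (Some j)) \<le> K"
        using K[of j] b_nonneg[of n None] b_nonneg[of n "Some j"] by linarith
      then have "p j * (?\<kappa> None - b n None + (?\<kappa> (Some j) - b n (Some j))) \<le> p j * K"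
        using p_nonneg by (intro mult_left_mono)
      \<comment> \<open>An empty queue has weight \<open>1 / ?Z\<close>, which is at most
        \<open>1 / D\<close>.\<close>
      moreover have "p j * (K + \<epsilon>) \<le> 1 / D * (K + \<epsilon>)"
        using True Z D K_pos \<epsilon> by (intro mult_right_mono) (auto simp: p_def frac_le)
      ultimately show ?thesis by (simp add: algebra_simps)
    next
      case False
      have "?\<kappa> None - b n None + (?\<kappa> (Some j) - b n (Some j)) \<le> - \<epsilon>"
        using gap[of j] b_saturated_Some[of n j] False by simp
      then have "p j * (?\<kappa> None - b n None + (?\<kappa> (Some j) - b n (Some j))) \<le> p j * (- \<epsilon>)"
        using p_nonneg by (intro mult_left_mono)
      moreover have "0 \<le> (K + \<epsilon>) / D"
        using K_pos \<epsilon> D by simp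
      ultimately show ?thesis by (simp add: algebra_simps)
    qed
    moreover have "p j * (\<theta> * M j) \<le> p j * (\<epsilon> / 4)"
      using p_nonneg \<theta>(3) unfolding M_def by (intro mult_left_mono)
    ultimately show ?thesis by (simp add: algebra_simps)
  qed
  have "generator (lyapunov D \<theta>) n \<le> ?\<kappa> None - b n None
      + (\<Sum>j\<in>UNIV. p j * (?\<kappa> (Some j) - b n (Some j) + \<theta> * M j))"
    unfolding p_def M_def by (rule generator_lyapunov_le[OF D(1) \<theta>(1,2)])
  \<comment> \<open>Multiplying by the total weight \<open>1\<close> shares the drift of type
    \<open>0\<close> among the queues, so that each \<open>b n (Some j)\<close> meets
    \<open>b n None\<close> as in the capacity constraint.\<close>
  also have "\<dots> = (p0 + (\<Sum>j\<in>UNIV. p j)) * (?\<kappa> None - b n None)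
      + (\<Sum>j\<in>UNIV. p j * (?\<kappa> (Some j) - b n (Some j) + \<theta> * M j))"
    unfolding p_sum by simp
  also have "\<dots> = p0 * (?\<kappa> None - b n None)
      + (\<Sum>j\<in>UNIV. p j * (?\<kappa> None - b n None + (?\<kappa> (Some j) - b n (Some j) + \<theta> * M j)))"
    unfolding distrib_left[of _ "?\<kappa> None - b n None"] sum.distrib
    by (simp only: distrib_right sum_distrib_right add.assoc)
  also have "\<dots> \<le> (- \<epsilon> * p0 + \<epsilon> / 4)
      + (\<Sum>j\<in>UNIV. (- \<epsilon> * p j + \<epsilon> / 4 * p j) + (K + \<epsilon>) / D)"
    by (intro add_mono p0_term sum_mono p_term)
  also have "\<dots> = - \<epsilon> * (p0 + (\<Sum>j\<in>UNIV. p j)) + \<epsilon> / 4 + \<epsilon> / 4 * (\<Sum>j\<in>UNIV. p j)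
      + real CARD('k) * ((K + \<epsilon>) / D)"
    unfolding sum.distrib sum_distrib_left[symmetric] sum_constant by (simp add: algebra_simps)
  also have "\<dots> \<le> - \<epsilon> * 1 + \<epsilon> / 4 + \<epsilon> / 4 * 1 + \<epsilon> / 4"
  proof -
    have "real CARD('k) * ((K + \<epsilon>) / D) \<le> \<epsilon> / 4"
      using D by (simp add: pos_divide_le_eq)
    moreover have "\<epsilon> / 4 * (\<Sum>j\<in>UNIV. p j) \<le> \<epsilon> / 4 * 1"
      using p_sum p0_nonneg \<epsilon> by (intro mult_left_mono) auto
    ultimately show ?thesis unfolding p_sum by linarith
  qed
  finally show ?thesis by simp
qed

text \<open>\<open>1 \<le> D\<close> makes the logarithm, and hence the Lyapunov function,
  nonnegative.\<close>

lemma stable_control_if_drift: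
  assumes "finite F" "0 < \<epsilon>" "0 < \<theta>" "1 \<le> D"
    and "\<And>n. n \<notin> F \<Longrightarrow> generator (lyapunov D \<theta>) n \<le> - \<epsilon>"
  shows "stable_control \<nu> \<mu> b"
  unfolding stable_control_def
proof (rule foster_positive_recurrent)
  show "exit_rate (transition_rate \<nu> \<mu> b) n \<le> (\<Sum>r\<in>UNIV. \<nu> r + \<mu> r * (\<Sum>j\<in>UNIV. c j))" for n
    by (rule exit_rate_le)
  show "(n, m) \<in> {(x, y). 0 < transition_rate \<nu> \<mu> b x y}\<^sup>*" for n m
    using reach_zero zero_reach by (rule rtrancl_trans)
  show "0 \<le> lyapunov D \<theta> n" for n
    using assms weight_sum_ge[of D \<theta> n] \<mu>_pos[of None] by (simp add: lyapunov_def)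
qed (use assms in auto)

end

text \<open>The constants are chosen in the order \<epsilon>, \<theta>, \<open>D\<close>,
  \<open>a\<close>, all before \<open>b\<close> and \<open>F\<close> are fixed, so \<open>a\<close>
  is uniform over the controls.\<close>

theorem mainTheorem4:
  fixes \<nu> \<mu> \<kappa> :: "'k::finite option \<Rightarrow> real" and c :: "'k \<Rightarrow> real" and \<delta> :: real
  assumes "\<And>r. 0 < \<nu> r" and "\<And>r. 0 < \<mu> r" and "\<And>r. \<kappa> r = \<nu> r / \<mu> r"
    and "\<And>j. 0 < c j"
    and "\<And>j. \<kappa> None + \<kappa> (Some j) < c j"
    and "0 < \<delta>"
  shows "\<exists>a::real. a \<ge> 1 \<and>
    (\<forall>b :: 'k control. pareto_efficient c b \<longrightarrow>
      (\<exists>F. finite F \<and>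
        (\<forall>n. real (n_hat_max n) < a \<and> n \<notin> F \<longrightarrow> \<kappa> None - b n None \<le> - \<delta>)) \<longrightarrow>
      stable_control \<nu> \<mu> b)"
proof -
  note \<nu>_pos = assms(1) and \<mu>_pos = assms(2) and \<kappa> = assms(3) and c_pos = assms(4)
  have \<kappa>_pos: "0 < \<kappa> r" for r
    using \<nu>_pos \<mu>_pos \<kappa> by simp
  define M where "M = (\<lambda>j. (\<nu> (Some j) + \<mu> (Some j) * c j) / (\<mu> (Some j))\<^sup>2)"
  have M_pos: "0 < M j" for j
    using \<nu>_pos[of "Some j"] \<mu>_pos[of "Some j"] c_pos[of j]
    unfolding M_def by (intro divide_pos_pos add_pos_pos mult_pos_pos) auto
  have finite_lower_bound: "\<exists>m>0. \<forall>j. m \<le> f j" if "\<And>j. 0 < f j" for f :: "'k \<Rightarrow> real"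
    using that by (intro exI[of _ "Min (range f)"]) auto
  obtain \<epsilon>1 where \<epsilon>1: "0 < \<epsilon>1" "\<And>j. \<epsilon>1 \<le> c j - (\<kappa> None + \<kappa> (Some j))"
    using finite_lower_bound[of "\<lambda>j. c j - (\<kappa> None + \<kappa> (Some j))"] assms(5) by auto
  define \<epsilon> where "\<epsilon> = min \<delta> \<epsilon>1"
  have \<epsilon>: "0 < \<epsilon>" "\<epsilon> \<le> \<delta>" "\<And>j. \<epsilon> \<le> c j - (\<kappa> None + \<kappa> (Some j))"
    using \<epsilon>1 assms(6) unfolding \<epsilon>_def by (auto intro: min.coboundedI2)
  define K where "K = \<kappa> None + (\<Sum>j\<in>UNIV. \<kappa> (Some j))"
  have K: "\<kappa> None + \<kappa> (Some j) \<le> K" for j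
    unfolding K_def using \<kappa>_pos
    by (intro add_left_mono member_le_sum[of j UNIV "\<lambda>j. \<kappa> (Some j)"]) (auto simp: less_imp_le)
  have K_pos: "0 < K"
    using K[of undefined] \<kappa>_pos[of None] \<kappa>_pos[of "Some undefined"] by linarith
  obtain \<theta> where \<theta>: "0 < \<theta>" "\<And>j. \<theta> \<le> min (\<mu> (Some j)) (\<epsilon> / (4 * M j))"
    using finite_lower_bound[of "\<lambda>j. min (\<mu> (Some j)) (\<epsilon> / (4 * M j))"] \<mu>_pos M_pos \<epsilon>(1) by auto
  have \<theta>M: "\<theta> * M j \<le> \<epsilon> / 4" for j
    using \<theta>(2)[of j] M_pos[of j] by (simp add: pos_le_divide_eq mult_ac)
  \<comment> \<open>The summand \<open>1\<close> secures \<open>1 \<le> D\<close>; the other one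
    solves the requirement that all empty queues together cost at most
    \<open>\<epsilon> / 4\<close>.\<close>
  define D where "D = 1 + 4 * real CARD('k) * (K + \<epsilon>) / \<epsilon>"
  have D: "1 \<le> D" "real CARD('k) * (K + \<epsilon>) \<le> \<epsilon> / 4 * D"
    unfolding D_def using \<epsilon>(1) K_pos by (auto simp: field_simps)
  define m where "m = (\<Sum>j\<in>UNIV. \<mu> (Some j))"
  have m: "\<mu> (Some j) \<le> m" for j
    unfolding m_def using \<mu>_pos
    by (intro member_le_sum[of j UNIV "\<lambda>j. \<mu> (Some j)"]) (auto simp: less_imp_le)
  have m_pos: "0 < m"
    using m[of undefined] \<mu>_pos[of "Some undefined"] by linarith
  \<comment> \<open>Since \<open>exp y \<ge> y\<close>, a threshold linear in \<open>D\<close> is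
    enough; \<open>m\<close> bounds every \<open>\<mu> (Some j)\<close>, so that one
    \<open>a\<close> serves all queues.\<close>
  define a where "a = max 1 (4 * (K + \<epsilon>) * D * m / (\<epsilon> * \<theta>))"
  have a: "(K + \<epsilon>) * D \<le> \<epsilon> / 4 * exp (\<theta> * a / \<mu> (Some j))" for j
  proof -
    have "4 * (K + \<epsilon>) * D * m / (\<epsilon> * \<theta>) \<le> a"
      by (simp add: a_def)
    then have "(K + \<epsilon>) * D \<le> \<epsilon> / 4 * (\<theta> * a / m)"
      using \<epsilon>(1) \<theta>(1) m_pos by (simp add: field_simps)
    also have "\<theta> * a / m \<le> \<theta> * a / \<mu> (Some j)"
      using m[of j] \<mu>_pos[of "Some j"] \<theta>(1) by (intro divide_left_mono) (auto simp: a_def m_pos)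
    also have "\<dots> \<le> exp (\<theta> * a / \<mu> (Some j))"
      using exp_ge_add_one_self[of "\<theta> * a / \<mu> (Some j)"] by linarith
    finally show ?thesis using \<epsilon>(1) by simp
  qed
  show ?thesis
  proof (intro exI[of _ a] conjI allI impI)
    show "1 \<le> a" by (simp add: a_def)
    fix b :: "'k control"
    assume pareto: "pareto_efficient c b"
      and "\<exists>F. finite F \<and>
        (\<forall>n. real (n_hat_max n) < a \<and> n \<notin> F \<longrightarrow> \<kappa> None - b n None \<le> - \<delta>)"
    then obtain F where F: "finite F"
      "\<And>n. real (n_hat_max n) < a \<Longrightarrow> n \<notin> F \<Longrightarrow> \<kappa> None - b n None \<le> - \<delta>" by blast
    interpret pareto_control \<nu> \<mu> c b
      by standard (use \<nu>_pos \<mu>_pos c_pos pareto in auto)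
    have "generator (lyapunov D \<theta>) n \<le> - (\<epsilon> / 4)" if "n \<notin> F" for n
    proof -
      have "generator (lyapunov D \<theta>) n \<le> - \<epsilon> / 4"
      proof (rule generator_lyapunov_neg[where K = K and a = a])
        show "\<nu> None / \<mu> None + \<nu> (Some j) / \<mu> (Some j) + \<epsilon> \<le> c j" for j
          using \<epsilon>(3)[of j] by (simp add: \<kappa>)
        show "\<nu> None / \<mu> None + \<nu> (Some j) / \<mu> (Some j) \<le> K" for j
          using K[of j] by (simp add: \<kappa>)
        show "\<theta> * ((\<nu> (Some j) + \<mu> (Some j) * c j) / (\<mu> (Some j))\<^sup>2) \<le> \<epsilon> / 4" for j
          using \<theta>M[of j] by (simp add: M_def)
        show "\<nu> None / \<mu> None - b n None \<le> - \<epsilon>" if "real (n_hat_max n) < a"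
          using F(2)[OF that \<open>n \<notin> F\<close>] \<epsilon>(2) by (simp add: \<kappa>)
      qed (use \<epsilon> \<theta> D a in auto)
      then show ?thesis by simp
    qed
    then show "stable_control \<nu> \<mu> b"
      using F(1) \<epsilon>(1) \<theta>(1) D(1) by (intro stable_control_if_drift[of F "\<epsilon> / 4" \<theta> D]) auto
  qed
qed

end
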